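(* Let $p\in[1,\infty]$, let $1\le k\le m\le n$ be integers, let $A\in\mathbb{R}^{n\times m}$, and let $A^\star=U^\star V^\star$ with $U^\star\in\mathbb{R}^{n\times k}$, $V^\star\in\mathbb{R}^{k\times m}$ attain the minimum of $|A-U'V'|_p$ over all $U'\in\mathbb{R}^{n\times k}$, $V'\in\mathbb{R}^{k\times m}$. Put $\Delta=A-A^\star$, and assume that $A^\star$ has rank $k$ and that $|\Delta_i|_p>0$ for every $i\in\{1,\dots,m\}$. Let $\tilde A^\star\in\mathbb{R}^{n\times m}$ be the matrix with columns $\tilde A^\star_i=A^\star_i/|\Delta_i|_p$, write $\tilde A^\star=\tilde U\tilde V$ with $\tilde U\in\mathbb{R}^{n\times k}$, $\tilde V\in\mathbb{R}^{k\times m}$, and let $S=\{i_1,\dots,i_k\}\subseteq\{1,\dots,m\}$ be a set of $k$ column indices for which $|\det(\tilde V_S)|$ is maximum among all $k$-element sets of column indices. For each $i\in\{1,\dots,m\}$ let $M_i\in\mathbb{R}^k$ be a vector with $|M_i(j)|\le 1$ for all $j\in\{1,\dots,k\}$ and $\tilde A^\star_i=\sum_{j=1}^k M_i(j)\,\tilde A^\star_{i_j}$ (such vectors exist). Let $U=A_S=(A_{i_1},\dots,A_{i_k})\in\mathbb{R}^{n\times k}$, and let $V\in\mathbb{R}^{k\times m}$ be the matrix whose $i$th column is $$|\Delta_i|_p\cdot\left(\frac{M_i(1)}{|\Delta_{i_1}|_p},\dots,\frac{M_i(k)}{|\Delta_{i_k}|_p}\right)^T .$$ Then $|A_i-(UV)_i|_p\le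 (k+1)|\Delta_i|_p$ for every $i\in\{1,\dots,m\}$, and hence $|A-UV|_p\le (k+1)|\Delta|_p$.
   Context: For a matrix $M$, $M_i$ denotes its $i$th column, $M_{i,j}$ its $(i,j)$ entry, and $M_S$ the submatrix formed by the columns with indices in $S$. For matrices and vectors, $|M|_p=\left(\sum_{i,j}|M_{i,j}|^p\right)^{1/p}$ is the entrywise $\ell_p$ norm for $1\le p<\infty$, and $|M|_\infty=\max_{i,j}|M_{i,j}|$. For a vector $M_i\in\mathbb{R}^k$, $M_i(j)$ denotes its $j$th coordinate. *)

theory Defs
  imports "HOL-Analysis.Analysis"
begin

text \<open>
  An \<open>n \<times> m\<close> matrix is an element of \<open>real ^ 'm ^ 'n\<close>, with \<open>n = CARD('n)\<close> and
  \<open>m = CARD('m)\<close>; all dimensions are therefore at least 1.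
\<close>

text \<open>The exponent is an extended real, so that \<open>p = \<infinity>\<close> is allowed.\<close>

definition lp_norm :: "ereal \<Rightarrow> ('i::finite \<Rightarrow> real) \<Rightarrow> real" where
  "lp_norm p f =
     (if p = \<infinity> then Max (range (\<lambda>i. \<bar>f i\<bar>))
      else (\<Sum>i\<in>UNIV. \<bar>f i\<bar> powr real_of_ereal p) powr (1 / real_of_ereal p))"

definition vec_lp_norm :: "ereal \<Rightarrow> real ^ 'n \<Rightarrow> real" where
  "vec_lp_norm p x = lp_norm p (\<lambda>i. x $ i)"

definition mat_lp_norm :: "ereal \<Rightarrow> real ^ 'm ^ 'n \<Rightarrow> real" where
  "mat_lp_norm p M = lp_norm p (\<lambda>(i, j). M $ i $ j)"

text \<open>
  The submatrix formed by the columns with indices in a set \<open>S\<close> is taken along an enumeration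
  \<open>s\<close> of \<open>S\<close>, that is, \<open>bij_betw s UNIV S\<close>. By the lemma below, the absolute value of the
  determinant depends only on \<open>S\<close>.
\<close>

definition select_columns :: "'a ^ 'm ^ 'n \<Rightarrow> ('k \<Rightarrow> 'm) \<Rightarrow> 'a ^ 'k ^ 'n" where
  "select_columns M s = (\<chi> r j. M $ r $ s j)"

lemma abs_det_select_columns_cong:
  fixes V :: "real ^ 'm ^ 'k" and s t :: "'k \<Rightarrow> 'm"
  assumes s: "bij_betw s UNIV S" and t: "bij_betw t UNIV S"
  shows "\<bar>det (select_columns V s)\<bar> = \<bar>det (select_columns V t)\<bar>"
proof -
  define q where "q = inv_into UNIV s \<circ> t"
  have "bij q"
    unfolding q_def using t bij_betw_inv_into[OF s] by (rule bij_betw_trans)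
  hence q: "q permutes UNIV"
    by (intro bij_imp_permutes) auto
  have "s (q j) = t j" for j
    using bij_betw_inv_into_right[OF s] bij_betwE[OF t] by (simp add: q_def)
  hence "select_columns V t = (\<chi> r j. select_columns V s $ r $ q j)"
    by (simp add: select_columns_def)
  hence "det (select_columns V t) = of_int (sign q) * det (select_columns V s)"
    using det_permute_columns[OF q, of "select_columns V s"] by simp
  thus ?thesis
    by (simp add: abs_mult sign_def)
qed

definition max_abs_det_columns :: "real ^ 'm ^ 'k \<Rightarrow> ('k \<Rightarrow> 'm) \<Rightarrow> bool" where
  "max_abs_det_columns V s \<longleftrightarrow>
     (\<forall>T t. card T = CARD('k) \<longrightarrow> bij_betw t UNIV T \<longrightarrow>
        \<bar>det (select_columns V t)\<bar> \<le> \<bar>det (select_columns V s)\<bar>)"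

definition bounded_coefficients ::
    "real ^ 'm ^ 'n \<Rightarrow> ('k::finite \<Rightarrow> 'm) \<Rightarrow> ('m \<Rightarrow> real ^ 'k) \<Rightarrow> bool" where
  "bounded_coefficients B s M \<longleftrightarrow>
     (\<forall>i. (\<forall>j. \<bar>M i $ j\<bar> \<le> 1) \<and>
          column i B = (\<Sum>j\<in>UNIV. (M i $ j) *\<^sub>R column (s j) B))"

end

theory Submission
  imports Defs
begin

text \<open>
  Writing \<open>d\<^sub>i = |\<Delta>\<^sub>i|\<^sub>p\<close>, the relation \<open>A\<^sup>\<star>\<^sub>i / d\<^sub>i = \<Sum>\<^sub>j M\<^sub>i(j) A\<^sup>\<star>\<^bsub>i\<^sub>j\<^esub> / d\<^bsub>i\<^sub>j\<^esub>\<close> cancels the \<open>A\<^sup>\<star>\<close> part of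
  \<open>A\<^sub>i - (U V)\<^sub>i\<close> and leaves \<open>\<Delta>\<^sub>i - d\<^sub>i \<Sum>\<^sub>j M\<^sub>i(j) \<Delta>\<^bsub>i\<^sub>j\<^esub> / d\<^bsub>i\<^sub>j\<^esub>\<close>; each of the \<open>k + 1\<close> terms has norm at
  most \<open>d\<^sub>i\<close>. The coefficients exist by Cramer's rule: each is a quotient of the determinant of
  another choice of columns by the maximal one, which is nonzero because the rank is \<open>k\<close>.
\<close>

section \<open>Entrywise norms\<close>

text \<open>This is convexity of the \<open>q\<close>-th power on the closed half-line.
  \<open>powr_convex\<close> is applied at positive points; when one point is 0, the claim reduces
  to \<open>w powr q \<le> w\<close> for a weight \<open>w\<close> in [0, 1].\<close>

lemma powr_convex_combination:
  fixes x y u v q :: real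
  assumes "1 \<le> q" "0 \<le> x" "0 \<le> y" "0 \<le> u" "0 \<le> v" "u + v = 1"
  shows "(u * x + v * y) powr q \<le> u * x powr q + v * y powr q"
proof -
  have scaled: "(w * z) powr q \<le> w * z powr q" if "0 \<le> w" "w \<le> 1" for w z :: real
  proof -
    have "w powr q \<le> w"
      using powr_mono'[of 1 q w] assms(1) that by simp
    then show ?thesis
      by (simp add: powr_mult mult_right_mono)
  qed
  consider "x = 0" | "y = 0" | "0 < x" "0 < y"
    using assms by linarith
  then show ?thesis
  proof cases
    case 1
    then show ?thesis using scaled[of v y] assms by simp
  next
    case 2
    then show ?thesis using scaled[of u x] assms by simp
  next
    case 3
    have u: "u = 1 - v" using assms(6) by simp
    show ?thesis
      using convex_onD[OF powr_convex[OF assms(1)], of v x y] 3 assms(4,5) u by simp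
  qed
qed

lemma powr_le_powr_iff:
  fixes x y q :: real
  assumes "0 < q" "0 \<le> x" "0 \<le> y"
  shows "x powr q \<le> y powr q \<longleftrightarrow> x \<le> y"
  using powr_mono2[of q x y] powr_less_mono2[of q y x] assms by linarith

section \<open>Norm properties of \<open>lp_norm\<close>, up to Minkowski's inequality\<close>

lemma lp_norm_infinity_le_iff: "lp_norm \<infinity> f \<le> c \<longleftrightarrow> (\<forall>i. \<bar>f i\<bar> \<le> c)"
  by (auto simp: lp_norm_def)

lemma abs_le_lp_norm_infinity: "\<bar>f i\<bar> \<le> lp_norm \<infinity> f"
  using lp_norm_infinity_le_iff by blast

lemma lp_norm_powr:
  assumes "1 \<le> p" "p \<noteq> \<infinity>"
  shows "lp_norm p f powr real_of_ereal p = (\<Sum>i\<in>UNIV. \<bar>f i\<bar> powr real_of_ereal p)"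
  using assms by (cases p) (auto simp: lp_norm_def powr_powr sum_nonneg)

lemma lp_norm_nonneg: "0 \<le> lp_norm p f"
proof (cases "p = \<infinity>")
  case True
  then show ?thesis
    using abs_le_lp_norm_infinity[of f undefined] by simp
qed (simp add: lp_norm_def)

text \<open>Raising both nonnegative sides to the exponent removes the outer root, so that for
  finite \<open>p\<close> norm bounds become bounds on plain sums.\<close>

lemma lp_norm_le_iff:
  assumes "1 \<le> p" "p \<noteq> \<infinity>" "0 \<le> c"
  shows "lp_norm p f \<le> c \<longleftrightarrow>
    (\<Sum>i\<in>UNIV. \<bar>f i\<bar> powr real_of_ereal p) \<le> c powr real_of_ereal p"
proof -
  have "0 < real_of_ereal p"
    using assms by (cases p) auto
  then show ?thesis
    unfolding lp_norm_powr[OF assms(1,2), symmetric]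
    using lp_norm_nonneg[of p f] assms(3) by (simp add: powr_le_powr_iff)
qed

lemma lp_norm_eq_0D:
  assumes "1 \<le> p" "lp_norm p f = 0"
  shows "f i = 0"
proof (cases "p = \<infinity>")
  case True
  then show ?thesis
    using abs_le_lp_norm_infinity[of f i] assms by simp
next
  case False
  then have "(\<Sum>i\<in>UNIV. \<bar>f i\<bar> powr real_of_ereal p) = 0"
    using lp_norm_powr[of p f] assms by simp
  then show ?thesis
    by (simp add: sum_nonneg_eq_0_iff)
qed

lemma lp_norm_scale_le:
  assumes "1 \<le> p"
  shows "lp_norm p (\<lambda>i. c * f i) \<le> \<bar>c\<bar> * lp_norm p f"
proof (cases "p = \<infinity>")
  case True
  then show ?thesis
    using abs_le_lp_norm_infinity[of f]
    by (auto simp: lp_norm_infinity_le_iff abs_mult intro: mult_left_mono)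
next
  case False
  then show ?thesis
    using assms lp_norm_nonneg[of p f]
    by (simp add: lp_norm_le_iff abs_mult powr_mult lp_norm_powr sum_distrib_left)
qed

text \<open>Minkowski's inequality. For finite \<open>p\<close>, both functions are normalised to
  norm 1, and the sum, divided by the total of the two norms, becomes a pointwise convex combination
  of them; convexity of the power is then summed over all indices.\<close>

lemma lp_norm_triangle:
  assumes "1 \<le> p"
  shows "lp_norm p (\<lambda>i. f i + g i) \<le> lp_norm p f + lp_norm p g"
proof (cases "p = \<infinity>")
  case True
  have "\<bar>f i + g i\<bar> \<le> lp_norm \<infinity> f + lp_norm \<infinity> g" for i
    using abs_le_lp_norm_infinity[of f i] abs_le_lp_norm_infinity[of g i] by linarith
  then show ?thesis
    using True by (simp add: lp_norm_infinity_le_iff)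
next
  case False
  define q a b where "q = real_of_ereal p" and "a = lp_norm p f" and "b = lp_norm p g"
  have q: "1 \<le> q"
    using assms False by (cases p) (auto simp: q_def)
  \<comment> \<open>Normalising divides by \<open>a\<close> and \<open>b\<close>. A vanishing norm
    makes its function identically 0, and the claim is then trivial.\<close>
  consider "a = 0" | "b = 0" | "0 < a" "0 < b"
    using lp_norm_nonneg[of p f] lp_norm_nonneg[of p g] by (force simp: a_def b_def)
  then show ?thesis
  proof cases
    case 1
    then show ?thesis
      using lp_norm_eq_0D[OF assms, of f] by (simp add: a_def)
  next
    case 2
    then show ?thesis
      using lp_norm_eq_0D[OF assms, of g] by (simp add: b_def)
  next
    case 3
    \<comment> \<open>With these weights \<open>(a + b) * u = a\<close> and
      \<open>(a + b) * v = b\<close>, which gives the factorisation \<open>split\<close>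
      below.\<close>
    define u v where "u = a / (a + b)" and "v = b / (a + b)"
    have uv: "0 \<le> u" "0 \<le> v" "u + v = 1"
      using 3 by (auto simp: u_def v_def simp flip: add_divide_distrib)
    have *: "\<bar>f i + g i\<bar> powr q \<le>
        (a + b) powr q * (u * (\<bar>f i\<bar> powr q / a powr q) + v * (\<bar>g i\<bar> powr q / b powr q))" for i
    proof -
      have split: "\<bar>f i\<bar> + \<bar>g i\<bar> = (a + b) * (u * (\<bar>f i\<bar> / a) + v * (\<bar>g i\<bar> / b))"
        using 3 by (simp add: u_def v_def distrib_left)
      have "\<bar>f i + g i\<bar> powr q \<le> (\<bar>f i\<bar> + \<bar>g i\<bar>) powr q"
        using q by (intro powr_mono2) auto
      also have "\<dots> = (a + b) powr q * (u * (\<bar>f i\<bar> / a) + v * (\<bar>g i\<bar> / b)) powr q"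
        unfolding split by (rule powr_mult)
      also have "\<dots> \<le> (a + b) powr q * (u * (\<bar>f i\<bar> / a) powr q + v * (\<bar>g i\<bar> / b) powr q)"
        using 3 uv q by (intro mult_left_mono powr_convex_combination) auto
      finally show ?thesis
        by (simp add: powr_divide)
    qed
    have sums: "(\<Sum>i\<in>UNIV. \<bar>f i\<bar> powr q) = a powr q" "(\<Sum>i\<in>UNIV. \<bar>g i\<bar> powr q) = b powr q"
      by (simp_all add: a_def b_def q_def lp_norm_powr[OF assms False])
    have "(\<Sum>i\<in>UNIV. \<bar>f i + g i\<bar> powr q) \<le> (\<Sum>i\<in>UNIV. (a + b) powr q *
        (u * (\<bar>f i\<bar> powr q / a powr q) + v * (\<bar>g i\<bar> powr q / b powr q)))"
      by (intro sum_mono *)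
    also have "\<dots> = (a + b) powr q * (u * ((\<Sum>i\<in>UNIV. \<bar>f i\<bar> powr q) / a powr q)
        + v * ((\<Sum>i\<in>UNIV. \<bar>g i\<bar> powr q) / b powr q))"
      by (simp add: sum.distrib flip: sum_distrib_left sum_divide_distrib)
    \<comment> \<open>Each normalised sum is 1, and the weights add up to 1.\<close>
    also have "\<dots> = (a + b) powr q"
      using 3 uv by (simp add: sums)
    finally show ?thesis
      using 3 assms False by (simp add: lp_norm_le_iff a_def b_def q_def)
  qed
qed

section \<open>Vector norms, and matrix norms column by column\<close>

lemma vec_lp_norm_nonneg: "0 \<le> vec_lp_norm p x"
  by (simp add: vec_lp_norm_def lp_norm_nonneg)

lemma vec_lp_norm_scaleR_le: "1 \<le> p \<Longrightarrow> vec_lp_norm p (c *\<^sub>R x) \<le> \<bar>c\<bar> * vec_lp_norm p x"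
  using lp_norm_scale_le[of p c "\<lambda>i. x $ i"] by (simp add: vec_lp_norm_def)

lemma vec_lp_norm_triangle: "1 \<le> p \<Longrightarrow> vec_lp_norm p (x + y) \<le> vec_lp_norm p x + vec_lp_norm p y"
  using lp_norm_triangle[of p "\<lambda>i. x $ i" "\<lambda>i. y $ i"] by (simp add: vec_lp_norm_def)

lemma vec_lp_norm_0:
  assumes "1 \<le> p"
  shows "vec_lp_norm p (0 :: real ^ 'n) = 0"
  using vec_lp_norm_scaleR_le[OF assms, of 0 "0 :: real ^ 'n"]
    vec_lp_norm_nonneg[of p "0 :: real ^ 'n"] by simp

lemma vec_lp_norm_sum:
  assumes "1 \<le> p"
  shows "vec_lp_norm p (\<Sum>j\<in>T. x j) \<le> (\<Sum>j\<in>T. vec_lp_norm p (x j))"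
proof (induction T rule: infinite_finite_induct)
  case (insert j T)
  then show ?case
    using vec_lp_norm_triangle[OF assms, of "x j" "\<Sum>j\<in>T. x j"] by simp
qed (simp_all add: vec_lp_norm_0 assms)

lemma mat_lp_norm_powr:
  fixes X :: "real ^ 'm ^ 'n"
  assumes "1 \<le> p" "p \<noteq> \<infinity>"
  shows "mat_lp_norm p X powr real_of_ereal p =
    (\<Sum>j\<in>UNIV. vec_lp_norm p (column j X) powr real_of_ereal p)"
proof -
  have "mat_lp_norm p X powr real_of_ereal p =
      (\<Sum>(i, j)\<in>UNIV \<times> UNIV. \<bar>X $ i $ j\<bar> powr real_of_ereal p)"
    using assms by (simp add: mat_lp_norm_def lp_norm_powr split_def)
  also have "\<dots> = (\<Sum>j\<in>UNIV. \<Sum>i\<in>UNIV. \<bar>X $ i $ j\<bar> powr real_of_ereal p)"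
    by (subst sum.cartesian_product[symmetric], rule sum.swap)
  finally show ?thesis
    using assms by (simp add: vec_lp_norm_def lp_norm_powr column_def)
qed

text \<open>For finite \<open>p\<close> the \<open>p\<close>-th powers of the column norms add up to
  that of the matrix norm, so the columnwise bounds can be summed. For
  \<open>p = \<infinity>\<close> every entry is bounded by the norm of its column.\<close>

lemma mat_lp_norm_le_columns:
  fixes X Y :: "real ^ 'm ^ 'n"
  assumes p: "1 \<le> p" and c: "0 \<le> c"
    and le: "\<And>j. vec_lp_norm p (column j X) \<le> c * vec_lp_norm p (column j Y)"
  shows "mat_lp_norm p X \<le> c * mat_lp_norm p Y"
proof (cases "p = \<infinity>")
  case True
  have "\<bar>X $ i $ j\<bar> \<le> c * lp_norm \<infinity> (\<lambda>(i, j). Y $ i $ j)" for i j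
  proof -
    have "\<bar>X $ i $ j\<bar> \<le> vec_lp_norm p (column j X)"
      using abs_le_lp_norm_infinity[of "\<lambda>i. X $ i $ j" i] True
      by (simp add: vec_lp_norm_def column_def)
    also have "\<dots> \<le> c * vec_lp_norm p (column j Y)"
      by (rule le)
    also have "vec_lp_norm p (column j Y) \<le> lp_norm \<infinity> (\<lambda>(i, j). Y $ i $ j)"
      using abs_le_lp_norm_infinity[of "\<lambda>(i, j). Y $ i $ j" "(_, j)"] True
      by (simp add: vec_lp_norm_def column_def lp_norm_infinity_le_iff)
    finally show ?thesis
      using c by (simp add: mult_left_mono)
  qed
  then show ?thesis
    using True by (simp add: mat_lp_norm_def lp_norm_infinity_le_iff)
next
  case False
  define q where "q = real_of_ereal p"
  have q: "0 < q"
    using p False by (cases p) (auto simp: q_def)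
  have "mat_lp_norm p X powr q \<le> (\<Sum>j\<in>UNIV. (c * vec_lp_norm p (column j Y)) powr q)"
    unfolding q_def mat_lp_norm_powr[OF p False]
    using q by (intro sum_mono powr_mono2 le vec_lp_norm_nonneg) (simp add: q_def)
  also have "\<dots> = (c * mat_lp_norm p Y) powr q"
    using mat_lp_norm_powr[OF p False, of Y]
    by (simp add: powr_mult q_def flip: sum_distrib_left)
  finally show ?thesis
    using q c by (simp add: powr_le_powr_iff mat_lp_norm_def lp_norm_nonneg)
qed

section \<open>Column choices of maximal determinant\<close>

lemma column_select_columns: "column j (select_columns M s) = column (s j) M"
  by (simp add: select_columns_def column_def)

lemma column_matrix_mult: "column i (X ** Y) = X *v column i Y"
  by (simp add: column_def matrix_matrix_mult_def matrix_vector_mult_def)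

lemma select_columns_mult: "select_columns (X ** Y) s = X ** select_columns Y s"
  by (simp add: select_columns_def matrix_matrix_mult_def vec_eq_iff)

text \<open>A basis of the column space can be chosen among the columns. Full row rank gives it
  \<open>CARD('k)\<close> elements, so that they form an invertible square matrix.\<close>

lemma ex_det_select_columns_nonzero:
  fixes V :: "real ^ 'm ^ 'k"
  assumes "rank V = CARD('k)"
  obtains t :: "'k \<Rightarrow> 'm" where "inj t" "det (select_columns V t) \<noteq> 0"
proof -
  obtain B where B: "B \<subseteq> columns V" "independent B" "columns V \<subseteq> span B" "card B = CARD('k)"
    using basis_exists[of "columns V"] assms by (metis column_rank_def)
  have "finite B"
    using B(2) by (rule finiteI_independent)
  then obtain h :: "'k \<Rightarrow> real ^ 'k" where h: "bij_betw h UNIV B"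
    using finite_same_card_bij[of "UNIV :: 'k set" B] B(4) by auto
  have "\<forall>j. \<exists>i. h j = column i V"
    using bij_betwE[OF h] B(1) by (auto simp: columns_def)
  then obtain t where t: "\<And>j. h j = column (t j) V"
    by metis
  have "inj t"
    using bij_betw_imp_inj_on[OF h] t by (metis injI injD)
  have "columns (select_columns V t) = B"
    using bij_betw_imp_surj_on[OF h] by (auto simp: columns_def column_select_columns t)
  \<comment> \<open>The number of independent vectors in \<open>B\<close> equals the dimension of
    the whole space.\<close>
  moreover have "span B = UNIV"
    using B(2,4) by (intro card_ge_dim_independent[of B UNIV, THEN subset_antisym[rotated]]) (auto)
  ultimately have "invertible (select_columns V t)"
    by (simp add: invertible_right_inverse matrix_right_invertible_span_columns span_vec_eq)
  then show thesis
    using that \<open>inj t\<close> by (simp add: invertible_det_nz)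
qed

text \<open>The coefficients come from Cramer's rule, and maximality of the denominator bounds them
  by 1.\<close>

lemma max_abs_det_columns_coefficients:
  fixes V :: "real ^ 'm ^ 'k"
  assumes rank: "rank V = CARD('k)" and max: "max_abs_det_columns V s"
  obtains c where "select_columns V s *v c = column i V" "\<And>j. \<bar>c $ j\<bar> \<le> 1"
proof -
  let ?D = "det (select_columns V s)"
  \<comment> \<open>Maximality compares only choices of \<open>CARD('k)\<close> distinct columns,
    hence the restriction to injective \<open>t\<close>.\<close>
  have le: "\<bar>det (select_columns V t)\<bar> \<le> \<bar>?D\<bar>" if "inj t" for t
    using max that unfolding max_abs_det_columns_def
    by (meson card_image inj_on_imp_bij_betw)
  have D: "?D \<noteq> 0"
    using ex_det_select_columns_nonzero[OF rank] le by force
  \<comment> \<open>Cramer's numerator replaces the \<open>j\<close>-th selected column by column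
    \<open>i\<close> of \<open>V\<close>, which is the column choice
    \<open>s(j := i)\<close>.\<close>
  define c :: "real ^ 'k" where "c = (\<chi> j. det (select_columns V (s(j := i))) / ?D)"
  have "(\<chi> r l. if l = j then column i V $ r else select_columns V s $ r $ l)
      = select_columns V (s(j := i))" for j
    by (simp add: select_columns_def column_def vec_eq_iff)
  then have "select_columns V s *v c = column i V"
    using cramer[OF D, of c "column i V"] by (simp add: c_def)
  moreover have "\<bar>c $ j\<bar> \<le> 1" for j
  proof (cases "inj (s(j := i))")
    case True
    then show ?thesis
      using le[OF True] D by (simp add: c_def)
  next
    case False
    \<comment> \<open>If \<open>i\<close> is already selected at another position, a column is
      repeated and the numerator is 0.\<close>
    then obtain a b where "a \<noteq> b" "(s(j := i)) a = (s(j := i)) b"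
      by (auto simp: inj_def)
    then have "det (select_columns V (s(j := i))) = 0"
      by (intro det_identical_columns[of a b]) (simp_all add: column_select_columns del: fun_upd_apply)
    then show ?thesis
      by (simp add: c_def)
  qed
  ultimately show thesis
    using that by blast
qed

text \<open>Multiplication by \<open>U\<close> from the left preserves linear relations between
  columns, so the coefficients found for \<open>V\<close> also serve for
  \<open>U ** V\<close>.\<close>

lemma ex_bounded_coefficients:
  fixes U :: "real ^ 'k ^ 'n" and V :: "real ^ 'm ^ 'k"
  assumes "rank V = CARD('k)" "max_abs_det_columns V s"
  shows "\<exists>M. bounded_coefficients (U ** V) s M"
proof -
  have "\<exists>c. select_columns V s *v c = column i V \<and> (\<forall>j. \<bar>c $ j\<bar> \<le> 1)" for i
    using max_abs_det_columns_coefficients[OF assms] by metis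
  then obtain M where M: "\<And>i. select_columns V s *v M i = column i V" "\<And>i j. \<bar>M i $ j\<bar> \<le> 1"
    by metis
  have "column i (U ** V) = (\<Sum>j\<in>UNIV. (M i $ j) *\<^sub>R column (s j) (U ** V))" for i
  proof -
    have "column i (U ** V) = select_columns (U ** V) s *v M i"
      by (simp add: column_matrix_mult select_columns_mult M(1) flip: matrix_vector_mul_assoc)
    then show ?thesis
      by (simp add: matrix_mult_sum column_select_columns scalar_mult_eq_scaleR)
  qed
  then show ?thesis
    using M(2) unfolding bounded_coefficients_def by blast
qed

text \<open>Scaling columns is right multiplication by a diagonal matrix, which cannot raise the
  rank.\<close>

lemma rank_scale_columns_le:
  fixes X Y :: "real ^ 'm ^ 'n"
  assumes "\<And>i. column i X = d i *\<^sub>R column i Y"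
  shows "rank X \<le> rank Y"
proof -
  define D :: "real ^ 'm ^ 'm" where "D = (\<chi> r i. if r = i then d i else 0)"
  have "X $ r $ i = (Y ** D) $ r $ i" for r i
  proof -
    have "X $ r $ i = Y $ r $ i * d i"
      using arg_cong[OF assms[of i], of "\<lambda>v. v $ r"] by (simp add: column_def)
    also have "\<dots> = (\<Sum>l\<in>UNIV. if l = i then Y $ r $ l * d i else 0)"
      by simp
    finally show ?thesis
      by (simp add: D_def matrix_matrix_mult_def if_distrib cong: if_cong)
  qed
  then have "X = Y ** D"
    by (simp only: vec_eq_iff) simp
  then show ?thesis
    using rank_mul_le_left[of Y D] by simp
qed

section \<open>The approximation bound\<close>

text \<open>A purely algebraic identity, valid for arbitrary nonzero weights \<open>d\<close>; norms
  enter only afterwards.\<close>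

lemma column_residual:
  fixes A B \<Delta> X :: "real ^ 'm ^ 'n" and V :: "real ^ 'm ^ 'k" and M :: "'m \<Rightarrow> real ^ 'k"
  assumes \<Delta>: "\<Delta> = A - B" and d: "\<And>i. d i \<noteq> 0"
    and X: "\<And>i. column i X = (1 / d i) *\<^sub>R column i B"
    and M: "bounded_coefficients X s M"
    and V: "column i V = d i *\<^sub>R (\<chi> j. M i $ j / d (s j))"
  shows "column i A - column i (select_columns A s ** V) =
    column i \<Delta> + (\<Sum>j\<in>UNIV. (- (d i * M i $ j / d (s j))) *\<^sub>R column (s j) \<Delta>)"
proof -
  have A: "column l A = column l B + column l \<Delta>" for l
    by (simp add: \<Delta> column_def vec_eq_iff)
  \<comment> \<open>Undoing the normalisation turns the coefficient \<open>M i $ j\<close> into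
    \<open>d i * M i $ j / d (s j)\<close>, which is exactly the entry of \<open>V\<close>.\<close>
  have "column i B = d i *\<^sub>R column i X"
    using d[of i] by (simp add: X)
  also have "\<dots> = d i *\<^sub>R (\<Sum>j\<in>UNIV. (M i $ j) *\<^sub>R column (s j) X)"
    using M unfolding bounded_coefficients_def by metis
  also have "\<dots> = (\<Sum>j\<in>UNIV. (d i * M i $ j / d (s j)) *\<^sub>R column (s j) B)"
    by (simp add: X scaleR_sum_right)
  finally have B: "column i B = (\<Sum>j\<in>UNIV. (d i * M i $ j / d (s j)) *\<^sub>R column (s j) B)" .
  have "column i (select_columns A s ** V) =
      (\<Sum>j\<in>UNIV. (d i * M i $ j / d (s j)) *\<^sub>R column (s j) A)"
    by (simp add: column_matrix_mult matrix_mult_sum V column_select_columns scalar_mult_eq_scaleR)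
  also have "\<dots> = column i B + (\<Sum>j\<in>UNIV. (d i * M i $ j / d (s j)) *\<^sub>R column (s j) \<Delta>)"
    unfolding A scaleR_add_right sum.distrib using B by simp
  finally show ?thesis
    by (simp add: A[of i] sum_negf)
qed

text \<open>The factor counts the terms: one for \<open>x\<close> and one for each of the
  \<open>CARD('k)\<close> summands, each of norm at most \<open>D\<close>.\<close>

lemma vec_lp_norm_add_scaled_sum_le:
  fixes y :: "'k::finite \<Rightarrow> real ^ 'n"
  assumes p: "1 \<le> p" and x: "vec_lp_norm p x \<le> D"
    and c: "\<And>j. \<bar>c j\<bar> * vec_lp_norm p (y j) \<le> D"
  shows "vec_lp_norm p (x + (\<Sum>j\<in>UNIV. c j *\<^sub>R y j)) \<le> (real CARD('k) + 1) * D"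
proof -
  have "vec_lp_norm p (\<Sum>j\<in>UNIV. c j *\<^sub>R y j) \<le> (\<Sum>j\<in>UNIV. vec_lp_norm p (c j *\<^sub>R y j))"
    by (rule vec_lp_norm_sum[OF p])
  also have "\<dots> \<le> real CARD('k) * D"
    by (intro sum_bounded_above order.trans[OF vec_lp_norm_scaleR_le[OF p] c])
  finally show ?thesis
    using vec_lp_norm_triangle[OF p, of x "\<Sum>j\<in>UNIV. c j *\<^sub>R y j"] x by (simp add: distrib_right)
qed

theorem theorem3:
  fixes p :: ereal
    and A Astar \<Delta> Atilde :: "real ^ 'm ^ 'n"
    and Ustar Utilde :: "real ^ 'k ^ 'n"
    and Vstar Vtilde :: "real ^ 'm ^ 'k"
    and S :: "'m set"
    and s :: "'k \<Rightarrow> 'm"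
  assumes "1 \<le> p"
    and "CARD('k) \<le> CARD('m)" and "CARD('m) \<le> CARD('n)"
    and "Astar = Ustar ** Vstar"
    and "\<forall>(U' :: real ^ 'k ^ 'n) (V' :: real ^ 'm ^ 'k).
           mat_lp_norm p (A - Ustar ** Vstar) \<le> mat_lp_norm p (A - U' ** V')"
    and "\<Delta> = A - Astar"
    and "rank Astar = CARD('k)"
    and "\<forall>i. vec_lp_norm p (column i \<Delta>) > 0"
    and "\<forall>i. column i Atilde = (1 / vec_lp_norm p (column i \<Delta>)) *\<^sub>R column i Astar"
    and "Atilde = Utilde ** Vtilde"
    and "card S = CARD('k)" and "bij_betw s UNIV S"
    and "max_abs_det_columns Vtilde s"
  shows "(\<exists>M. bounded_coefficients Atilde s M) \<and>
    (\<forall>(M :: 'm \<Rightarrow> real ^ 'k) (U :: real ^ 'k ^ 'n) (V :: real ^ 'm ^ 'k).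
       bounded_coefficients Atilde s M \<longrightarrow>
       U = select_columns A s \<longrightarrow>
       (\<forall>i. column i V = vec_lp_norm p (column i \<Delta>) *\<^sub>R
              (\<chi> j. M i $ j / vec_lp_norm p (column (s j) \<Delta>))) \<longrightarrow>
       (\<forall>i. vec_lp_norm p (column i A - column i (U ** V))
              \<le> (real CARD('k) + 1) * vec_lp_norm p (column i \<Delta>)) \<and>
       mat_lp_norm p (A - U ** V) \<le> (real CARD('k) + 1) * mat_lp_norm p \<Delta>)"
proof -
  define d where "d i = vec_lp_norm p (column i \<Delta>)" for i
  have d: "0 < d i" for i
    using assms(8) by (simp add: d_def)
  have X: "column i Atilde = (1 / d i) *\<^sub>R column i Astar" for i
    using assms(9) by (simp add: d_def)
  \<comment> \<open>Scaling back shows that normalising did not lower the rank. The rank of a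
    product is at most that of its right factor, so \<open>Vtilde\<close> has full row rank.\<close>
  have "column i Astar = d i *\<^sub>R column i Atilde" for i
    using d[of i] by (simp add: X)
  then have "CARD('k) \<le> rank Atilde"
    using rank_scale_columns_le[of Astar d Atilde] assms(7) by simp
  also have "\<dots> \<le> rank Vtilde"
    unfolding assms(10) by (rule rank_mul_le_right)
  finally have "rank Vtilde = CARD('k)"
    using rank_bound[of Vtilde] by simp
  then have "\<exists>M. bounded_coefficients Atilde s M"
    unfolding assms(10) using assms(13) by (rule ex_bounded_coefficients)
  moreover have columns: "vec_lp_norm p (column i A - column i (select_columns A s ** V))
      \<le> (real CARD('k) + 1) * d i"
    if M: "bounded_coefficients Atilde s M"
      and V: "\<forall>i. column i V = d i *\<^sub>R (\<chi> j. M i $ j / d (s j))"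
    for M :: "'m \<Rightarrow> real ^ 'k" and V :: "real ^ 'm ^ 'k" and i
  proof -
    \<comment> \<open>The norm of column \<open>s j\<close> of \<open>\<Delta>\<close> is
      \<open>d (s j)\<close> and cancels the denominator, leaving
      \<open>d i * \<bar>M i $ j\<bar>\<close>.\<close>
    have "\<bar>- (d i * M i $ j / d (s j))\<bar> * vec_lp_norm p (column (s j) \<Delta>) \<le> d i" for j
    proof -
      have "\<bar>M i $ j\<bar> \<le> 1"
        using M by (simp add: bounded_coefficients_def)
      then show ?thesis
        using d[of i] d[of "s j"] by (simp add: abs_mult flip: d_def)
    qed
    then show ?thesis
      unfolding column_residual[OF assms(6) less_imp_neq[OF d, symmetric] X M spec[OF V]]
      by (intro vec_lp_norm_add_scaled_sum_le assms(1)) (simp_all add: d_def)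
  qed
  moreover have "mat_lp_norm p (A - select_columns A s ** V) \<le> (real CARD('k) + 1) * mat_lp_norm p \<Delta>"
    if "bounded_coefficients Atilde s M"
      and "\<forall>i. column i V = d i *\<^sub>R (\<chi> j. M i $ j / d (s j))"
    for M :: "'m \<Rightarrow> real ^ 'k" and V :: "real ^ 'm ^ 'k"
  proof (rule mat_lp_norm_le_columns[OF assms(1)])
    fix i
    have "column i (A - select_columns A s ** V) = column i A - column i (select_columns A s ** V)"
      by (simp add: column_def vec_eq_iff)
    then show "vec_lp_norm p (column i (A - select_columns A s ** V))
        \<le> (real CARD('k) + 1) * vec_lp_norm p (column i \<Delta>)"
      using columns[OF that, of i] by (simp add: d_def)
  qed simp
  ultimately show ?thesis
    unfolding d_def by blast
qed

end
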